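(* Let $q$ be a power of a prime, let $m$ and $n$ be positive integers with $m\le n$, and let $r$ be an integer with $1\le r\le m$. Let $\mathcal{M}$ be a constant rank $r$ subspace of $M_{m\times n}(\mathbb{F}_q)$. Suppose that $q\ge r+1$. Then $\dim_{\mathbb{F}_q}\mathcal{M}\le n$.
   Context: $\mathbb{F}_q$ denotes the finite field of order $q$, and $M_{m\times n}(K)$ denotes the $K$-vector space of $m\times n$ matrices with entries in a field $K$. A non-zero $K$-subspace $\mathcal{M}$ of $M_{m\times n}(K)$ is called a constant rank $r$ subspace if every non-zero element of $\mathcal{M}$ has rank exactly $r$. *)

theory Defs
  imports "HOL-Analysis.Analysis"
begin

text \<open>
  The space of \<open>m \<times> n\<close> matrices over a field \<open>'a\<close> is the type \<open>'a^'n^'m\<close>, with \<open>m = CARD('m)\<close>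
  rows and \<open>n = CARD('n)\<close> columns. HOL-Analysis has no scalar multiplication turning this type into
  a vector space over \<open>'a\<close> (\<open>*s\<close> on \<open>'a^'n^'m\<close> takes its scalars from the rows \<open>'a^'n\<close>, and \<open>*\<^sub>R\<close>
  is confined to real scalars), so it is introduced here.
\<close>

definition matrix_scale :: "'a::field \<Rightarrow> 'a^'n^'m \<Rightarrow> 'a^'n^'m"
  where "matrix_scale c A = (\<chi> i j. c * A $ i $ j)"

interpretation matrix_space: vector_space "matrix_scale :: 'a::field \<Rightarrow> 'a^'n^'m \<Rightarrow> 'a^'n^'m"
  by unfold_locales (simp_all add: matrix_scale_def vec_eq_iff algebra_simps)

definition constant_rank_subspace :: "nat \<Rightarrow> ('a::field^'n^'m) set \<Rightarrow> bool"
  where "constant_rank_subspace r M \<longleftrightarrow>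
    matrix_space.subspace M \<and> M \<noteq> {0} \<and> (\<forall>A\<in>M. A \<noteq> 0 \<longrightarrow> rank A = r)"

end

theory Submission
  imports Defs "HOL-Library.Cardinality"
begin

text \<open>
  Suppose \<open>dim M > n\<close>, and write \<open>M\<^sub>u = {A \<in> M. u A = 0}\<close> for a row vector \<open>u\<close>. Since \<open>A \<mapsto> u A\<close>
  takes values in an \<open>n\<close>-dimensional space, \<open>M\<^sub>u\<close> contains some \<open>A \<noteq> 0\<close>. As every combination
  \<open>B + x A\<close> has rank at most \<open>r = rank A\<close> and \<open>q > r\<close>, every \<open>u B\<close> with \<open>B \<in> M\<close> lies in the row
  space of \<open>A\<close>; hence \<open>\<bar>M\<^sub>u\<bar> \<ge> \<bar>M\<bar> / q\<^sup>r\<close> for all \<open>u\<close>. On the other hand, each non-zero \<open>A \<in> M\<close> is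
  annihilated by exactly \<open>q\<^sup>m / q\<^sup>r\<close> vectors \<open>u\<close>. Counting the pairs \<open>(u, A)\<close> with \<open>u A = 0\<close> in both
  ways gives \<open>\<bar>M\<bar> \<le> q\<^sup>m \<le> q\<^sup>n\<close>, a contradiction.
\<close>

section \<open>Cardinalities of vector spaces and kernels over a finite field\<close>

lemma (in vector_space) card_span_independent:
  assumes "finite (UNIV :: 'a set)" and "finite B" and "independent B"
  shows "card (span B) = CARD('a) ^ card B"
  using assms(2,3)
proof (induction B rule: finite_induct)
  case empty
  then show ?case by simp
next
  case (insert b B)
  have nb: "b \<notin> span B" and indep: "independent B"
    using insert by (auto simp: independent_insert)
  let ?f = "\<lambda>(c, y). c *s b + y"
  have "inj_on ?f (UNIV \<times> span B)"
  proof (rule inj_onI, clarify)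
    fix c y c' y'
    assume y: "y \<in> span B" "y' \<in> span B" and eq: "c *s b + y = c' *s b + y'"
    have *: "(c - c') *s b = y' - y"
      using eq by (simp add: algebra_simps)
    then have "(c - c') *s b \<in> span B"
      using y by (simp add: span_diff)
    then have "c = c'"
      using nb span_scale[of "(c - c') *s b" B "inverse (c - c')"] by (cases "c = c'") simp_all
    with eq show "c = c' \<and> y = y'" by simp
  qed
  moreover have "?f ` (UNIV \<times> span B) = span (insert b B)"
  proof
    show "?f ` (UNIV \<times> span B) \<subseteq> span (insert b B)"
    proof clarify
      fix c y
      assume "y \<in> span B"
      then show "c *s b + y \<in> span (insert b B)"
        unfolding span_breakdown_eq by (intro exI[of _ c]) simp
    qed
    show "span (insert b B) \<subseteq> ?f ` (UNIV \<times> span B)"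
    proof
      fix x
      assume "x \<in> span (insert b B)"
      then obtain k where "x - k *s b \<in> span B" by (auto simp: span_breakdown_eq)
      then show "x \<in> ?f ` (UNIV \<times> span B)"
        by (intro image_eqI[where x = "(k, x - k *s b)"]) auto
    qed
  qed
  ultimately have "card (span (insert b B)) = CARD('a) * card (span B)"
    by (metis card_cartesian_product card_image)
  then show ?case using insert indep by simp
qed

lemma (in vector_space) card_subspace:
  assumes "finite (UNIV :: 'a set)" and "finite S" and "subspace S"
  shows "card S = CARD('a) ^ dim S"
proof -
  obtain B where B: "B \<subseteq> S" "independent B" "S \<subseteq> span B" "card B = dim S"
    using basis_exists by blast
  then have "span B = S" using assms(3) span_subspace by blast
  with B card_span_independent[OF assms(1) _ B(2)] assms(2) show ?thesis
    by (metis finite_subset)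
qed

text \<open>Every non-empty fibre of \<open>f\<close> on the subgroup \<open>S\<close> is a
  translate of the kernel. It is applied both to \<open>M\<close> with \<open>u\<close> fixed and to
  all row vectors with \<open>A\<close> fixed.\<close>

lemma card_eq_card_image_mult_card_kernel:
  fixes f :: "'a::ab_group_add \<Rightarrow> 'b::ab_group_add"
  assumes "finite S"
    and add: "\<And>x y. x \<in> S \<Longrightarrow> y \<in> S \<Longrightarrow> x + y \<in> S"
    and diff: "\<And>x y. x \<in> S \<Longrightarrow> y \<in> S \<Longrightarrow> x - y \<in> S"
    and f: "\<And>x y. f (x + y) = f x + f y"
  shows "card S = card (f ` S) * card {x \<in> S. f x = 0}"
proof -
  have f_diff: "f (x - y) = f x - f y" for x y
    using f[of "x - y" y] by simp
  have "card {x \<in> S. f x = y} = card {x \<in> S. f x = 0}" if "y \<in> f ` S" for y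
  proof -
    obtain z where z: "z \<in> S" "y = f z" using \<open>y \<in> f ` S\<close> by blast
    then show ?thesis
      by (intro bij_betw_same_card[of "\<lambda>x. x - z"] bij_betw_byWitness[where f' = "\<lambda>x. x + z"])
        (auto simp: f f_diff add diff)
  qed
  then have "(\<Sum>x\<in>S. card {y \<in> f ` S. f x = y}) = card {x \<in> S. f x = 0} * card (f ` S)"
    by (intro sum_multicount) (auto simp: assms)
  moreover have "{y \<in> f ` S. f x = y} = {f x}" if "x \<in> S" for x
    using that by auto
  ultimately show ?thesis by (simp add: mult.commute)
qed

section \<open>Row vectors acting on matrices, and the row space\<close>

lemma linear_vector_matrix_mult: "Vector_Spaces.linear (*s) (*s) (\<lambda>u. u v* (A :: 'a::field^'n^'m))"
proof -
  have "(*v) (transpose A) = (\<lambda>u. u v* A)" by (simp add: fun_eq_iff)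
  with matrix_vector_mul_linear_gen[of "transpose A"] show ?thesis by (rule subst[rotated])
qed

lemma range_vector_matrix_mult: "range (\<lambda>u. u v* (A :: 'a::field^'n^'m)) = vec.span (rows A)"
proof
  show "range (\<lambda>u. u v* A) \<subseteq> vec.span (rows A)"
    using matrix_vector_mult_in_columnspace_gen[of "transpose A"] by auto
  have "rows A \<subseteq> range (\<lambda>u. u v* A)"
  proof
    fix y
    assume "y \<in> rows A"
    then obtain i where "y = row i A" by (auto simp: rows_def)
    then have "y = axis i 1 v* A"
      by (simp add: vec_eq_iff row_def vector_matrix_mult_def axis_def if_distrib[of "\<lambda>x. x * _"]
          cong: if_cong)
    then show "y \<in> range (\<lambda>u. u v* A)" by blast
  qed
  moreover have "vec.subspace (range (\<lambda>u. u v* A))"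
    using vec.linear_subspace_image[OF linear_vector_matrix_mult vec.subspace_UNIV] .
  ultimately show "vec.span (rows A) \<subseteq> range (\<lambda>u. u v* A)"
    by (rule vec.span_minimal)
qed

lemma card_range_vector_matrix_mult:
  fixes A :: "'a::{field,finite}^'n^'m"
  shows "card (range (\<lambda>u. u v* A)) = CARD('a) ^ rank A"
  by (simp add: range_vector_matrix_mult row_rank_def_gen vec.card_subspace)

lemma vector_matrix_scale: "u v* matrix_scale x A = x *s (u v* A)"
  by (simp add: vec_eq_iff vector_matrix_mult_def matrix_scale_def sum_distrib_left algebra_simps)

text \<open>
  If \<open>g v\<close> were outside the range of \<open>f\<close>, then by pigeonhole every scalar \<open>x\<close> would be an
  eigenvalue of the pencil, \<open>g w\<^sub>x = - x f w\<^sub>x\<close>, with \<open>w\<^sub>x\<close> in the space spanned by \<open>v\<close> and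
  a complement of the kernel of \<open>f\<close>. The usual argument for eigenvectors shows that the vectors
  \<open>f w\<^sub>x\<close> are linearly independent, but there are more of them than the rank of \<open>f\<close>.
\<close>

lemma pencil_maps_kernel_to_range:
  fixes f g :: "'a::{field,finite}^'m \<Rightarrow> 'a^'n"
  assumes lf: "Vector_Spaces.linear (*s) (*s) f" and lg: "Vector_Spaces.linear (*s) (*s) g"
    and card_f: "card (range f) = CARD('a) ^ r"
    and card_pencil: "\<And>x. card (range (\<lambda>u. g u + x *s f u)) \<le> CARD('a) ^ r"
    and q: "r < CARD('a)"
    and v: "f v = 0"
  shows "g v \<in> range f"
proof (rule ccontr)
  assume gv: "g v \<notin> range f"
  interpret f: Vector_Spaces.linear "(*s)" "(*s)" f by (rule lf)
  interpret g: Vector_Spaces.linear "(*s)" "(*s)" g by (rule lg)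
  have q1: "1 < CARD('a)" using card_mono[of UNIV "{0, 1 :: 'a}"] by simp
  have sub: "vec.subspace (range f)"
    using vec.linear_subspace_image[OF lf vec.subspace_UNIV] .
  \<comment> \<open>The image of \<open>range f\<close> under \<open>h\<close> is a complement of
    the kernel of \<open>f\<close>.\<close>
  obtain h where lh: "Vector_Spaces.linear (*s) (*s) h" and fh: "\<And>z. z \<in> range f \<Longrightarrow> f (h z) = z"
    using vec.linear_exists_right_inverse_on[OF lf vec.subspace_UNIV] by auto
  interpret h: Vector_Spaces.linear "(*s)" "(*s)" h by (rule lh)
  have gv_scale: "t = 0" if "t *s g v \<in> range f" for t
    using vec.subspace_scale[OF sub that, of "inverse t"] gv
    by (cases "t = 0") (simp_all add: vector_smult_assoc)
  have "\<exists>z t. z \<in> range f \<and> z \<noteq> 0 \<and> g (h z + t *s v) = - x *s z" for x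
  proof -
    let ?k = "\<lambda>u. g u + x *s f u" and ?j = "\<lambda>(z, t). h z + t *s v"
    \<comment> \<open>Pigeonhole: \<open>?j\<close> is parametrised by \<open>q^(r+1)\<close> pairs,
      while \<open>?k\<close> takes at most \<open>q^r\<close> values.\<close>
    have "card ((\<lambda>p. ?k (?j p)) ` (range f \<times> UNIV)) \<le> card (range ?k)"
      by (intro card_mono) auto
    also have "\<dots> < CARD('a) ^ r * CARD('a)"
      using card_pencil[of x] q1 by (simp add: le_less_trans)
    also have "\<dots> = card (range f \<times> (UNIV :: 'a set))"
      by (simp add: card_cartesian_product card_f)
    finally have "\<not> inj_on (\<lambda>p. ?k (?j p)) (range f \<times> UNIV)"
      using pigeonhole by blast
    then obtain z t z' t' where zt: "z \<in> range f" "z' \<in> range f" "(z, t) \<noteq> (z', t')"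
      and eq: "?k (h z + t *s v) = ?k (h z' + t' *s v)"
      unfolding inj_on_def by fastforce
    have z: "z - z' \<in> range f" using vec.subspace_diff[OF sub] zt by blast
    have *: "g (h (z - z') + (t - t') *s v) = - x *s (z - z')"
      using eq
      by (simp add: f.add f.scale h.diff g.add g.scale g.diff fh zt v algebra_simps)
    have "z \<noteq> z'"
    proof
      assume "z = z'"
      with * have "(t - t') *s g v = 0" by (simp add: g.add g.scale g.diff)
      then have "t - t' = 0" by (intro gv_scale) (metis f.zero rangeI)
      with \<open>z = z'\<close> zt show False by simp
    qed
    with z * show ?thesis by (intro exI[of _ "z - z'"] exI[of _ "t - t'"]) simp
  qed
  then obtain z t where z: "\<And>x. z x \<in> range f" "\<And>x. z x \<noteq> 0"
    and gz: "\<And>x. g (h (z x) + t x *s v) = - x *s z x"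
    by metis
  have indep: "(\<Sum>x\<in>S. a x *s z x) = 0 \<Longrightarrow> \<forall>x\<in>S. a x = 0" for S a
    using finite[of S]
  proof (induction S arbitrary: a rule: finite_induct)
    case empty
    then show ?case by simp
  next
    case (insert y S)
    let ?T = "\<Sum>x\<in>insert y S. a x * t x" and ?s = "\<Sum>x\<in>insert y S. (a x * x) *s z x"
    have "(\<Sum>x\<in>insert y S. a x *s (h (z x) + t x *s v))
        = h (\<Sum>x\<in>insert y S. a x *s z x) + ?T *s v"
      by (simp only: h.sum h.scale vec.scale_right_distrib sum.distrib vec.scale_sum_left
          vec.scale_scale)
    \<comment> \<open>The assumed relation kills the \<open>h\<close> part, so only a multiple of
      \<open>g v\<close> survives. By \<open>gz\<close> the same vector lies in
      \<open>range f\<close>, which forces \<open>?T = 0\<close> and then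
      \<open>?s = 0\<close>.\<close>
    then have "?T *s g v = g (\<Sum>x\<in>insert y S. a x *s (h (z x) + t x *s v))"
      by (simp add: insert.prems g.scale del: sum.insert)
    also have "\<dots> = - ?s"
      by (simp only: g.sum g.scale gz vec.scale_scale sum_negf[symmetric] mult_minus_right
          vec.scale_minus_left vec.scale_minus_right)
    finally have T: "?T *s g v = - ?s" .
    have "?s \<in> range f"
      by (intro vec.subspace_sum[OF sub] vec.subspace_scale[OF sub] z)
    then have "?T = 0"
      using T by (intro gv_scale) (simp only: vec.subspace_neg[OF sub])
    with T have "?s = 0" by (simp del: sum.insert)
    \<comment> \<open>Subtracting \<open>y\<close> times the relation from \<open>?s = 0\<close>
      eliminates \<open>z y\<close>; the factors \<open>x - y\<close> are non-zero on
      \<open>S\<close>.\<close>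
    moreover have "(\<Sum>x\<in>insert y S. (a x * (x - y)) *s z x)
        = ?s - y *s (\<Sum>x\<in>insert y S. a x *s z x)"
      by (simp only: right_diff_distrib vec.scale_left_diff_distrib sum_subtractf
          vec.scale_sum_right vec.scale_scale mult.commute)
    ultimately have "(\<Sum>x\<in>insert y S. (a x * (x - y)) *s z x) = 0"
      by (simp only: insert.prems vec.scale_zero_right diff_zero)
    then have "(\<Sum>x\<in>S. (a x * (x - y)) *s z x) = 0"
      using insert.hyps by simp
    from insert.IH[OF this] insert.hyps have S: "\<forall>x\<in>S. a x = 0" by auto
    with insert.prems insert.hyps z(2)[of y] show ?case by simp
  qed
  have "inj (\<lambda>a. \<Sum>x\<in>UNIV. a x *s z x)"
  proof (rule injI)
    fix a b
    assume "(\<Sum>x\<in>UNIV. a x *s z x) = (\<Sum>x\<in>UNIV. b x *s z x)"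
    then have "(\<Sum>x\<in>UNIV. (a x - b x) *s z x) = 0"
      by (simp add: vec.scale_left_diff_distrib sum_subtractf)
    from indep[OF this] show "a = b" by auto
  qed
  moreover have "range (\<lambda>a. \<Sum>x\<in>UNIV. a x *s z x) \<subseteq> range f"
    by (auto intro!: vec.subspace_sum[OF sub] vec.subspace_scale[OF sub] z)
  \<comment> \<open>Coefficient functions embed into \<open>range f\<close>, so
    \<open>q^q \<le> q^r\<close>, against \<open>r < q\<close>.\<close>
  ultimately have "CARD('a \<Rightarrow> 'a) \<le> card (range f)"
    by (intro card_inj_on_le) auto
  then show False
    using q q1 by (simp add: card_f card_fun)
qed

theorem corollary1:
  fixes M :: "('a::{field,finite}^'n^'m) set" and r :: nat
  assumes "CARD('m) \<le> CARD('n)"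
    and "1 \<le> r" and "r \<le> CARD('m)"
    and "constant_rank_subspace r M"
    and "CARD('a) \<ge> r + 1"
  shows "matrix_space.dim M \<le> CARD('n)"
proof (rule ccontr)
  let ?q = "CARD('a)"
  assume "\<not> matrix_space.dim M \<le> CARD('n)"
  then have dim: "CARD('n) < matrix_space.dim M" by simp
  have sub: "matrix_space.subspace M"
    and rank: "\<And>A. A \<in> M \<Longrightarrow> A \<noteq> 0 \<Longrightarrow> rank A = r"
    using assms(4) by (auto simp: constant_rank_subspace_def)
  have q1: "1 < ?q" using assms by simp
  have card_M: "card M = ?q ^ matrix_space.dim M"
    by (simp add: matrix_space.card_subspace sub)
  then have big: "?q ^ CARD('n) < card M"
    using dim q1 by simp
  have zero: "0 \<in> M" by (rule matrix_space.subspace_0[OF sub])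
  have card_M_split: "card M = card ((\<lambda>A. u v* A) ` M) * card {A \<in> M. u v* A = 0}" for u
    by (rule card_eq_card_image_mult_card_kernel)
      (simp_all add: matrix_space.subspace_add[OF sub] matrix_space.subspace_diff[OF sub]
        vector_matrix_mult_add_rdistrib)
  have kernel_big: "card M \<le> ?q ^ r * card {A \<in> M. u v* A = 0}" for u
  proof -
    have "card ((\<lambda>A. u v* A) ` M) \<le> ?q ^ CARD('n)"
      using card_mono[of UNIV "(\<lambda>A. u v* A) ` M"] by simp
    with big card_M_split[of u] have "card {A \<in> M. u v* A = 0} \<noteq> 1"
      by (metis leD mult.right_neutral)
    moreover have "{A \<in> M. u v* A = 0} = {0}" if "\<And>A. A \<in> M \<Longrightarrow> u v* A = 0 \<Longrightarrow> A = 0"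
      using that zero by auto
    ultimately obtain A where A: "A \<in> M" "u v* A = 0" "A \<noteq> 0" by fastforce
    have "u v* B \<in> range (\<lambda>u. u v* A)" if "B \<in> M" for B
    proof (rule pencil_maps_kernel_to_range[OF linear_vector_matrix_mult linear_vector_matrix_mult])
      show "card (range (\<lambda>u. u v* A)) = ?q ^ r"
        by (simp add: card_range_vector_matrix_mult rank A)
      show "r < ?q" using assms by simp
      show "u v* A = 0" by (rule A)
      fix x
      let ?C = "B + matrix_scale x A"
      have "?C \<in> M"
        using A that by (simp add: matrix_space.subspace_add matrix_space.subspace_scale sub)
      \<comment> \<open>If \<open>?C = 0\<close>, the range is a single point; only an upper bound
        holds for every \<open>x\<close>.\<close>
      then have "card (range (\<lambda>u. u v* ?C)) \<le> ?q ^ r"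
        using rank[of ?C] by (cases "?C = 0") (simp_all add: card_range_vector_matrix_mult Suc_le_eq)
      then show "card (range (\<lambda>u. u v* B + x *s (u v* A))) \<le> ?q ^ r"
        by (simp add: vector_matrix_mult_add_rdistrib vector_matrix_scale)
    qed
    then have "card ((\<lambda>A. u v* A) ` M) \<le> card (range (\<lambda>u. u v* A))"
      by (intro card_mono) auto
    then show ?thesis
      using card_M_split[of u] by (simp add: card_range_vector_matrix_mult rank A)
  qed
  have left_kernel: "?q ^ r * card {u. u v* A = 0} = ?q ^ CARD('m)" if "A \<in> M" "A \<noteq> 0" for A
    using card_eq_card_image_mult_card_kernel[of "UNIV :: ('a^'m) set" "\<lambda>u. u v* A"] that
    by (simp add: card_range_vector_matrix_mult rank vector_matrix_left_distrib)
  have double_count: "(\<Sum>u\<in>UNIV. card {A \<in> M. u v* A = 0}) = (\<Sum>A\<in>M. card {u. u v* A = 0})"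
    using sum.swap_restrict[of "UNIV :: ('a^'m) set" M "\<lambda>_ _. 1 :: nat" "\<lambda>u A. u v* A = 0"] by simp
  \<comment> \<open>The vector \<open>u = 0\<close> is split off because it is annihilated by all of
    \<open>M\<close> and contributes \<open>q^r * card M\<close>. With only the bound
    \<open>card M\<close> from \<open>kernel_big\<close> there, no contradiction would
    result.\<close>
  have "?q ^ r * card M + (?q ^ CARD('m) - 1) * card M
      \<le> ?q ^ r * card M + (\<Sum>u\<in>UNIV - {0}. ?q ^ r * card {A \<in> M. u v* A = 0})"
    using sum_bounded_below[of "UNIV - {0}" "card M" "\<lambda>u. ?q ^ r * card {A \<in> M. u v* A = 0}"]
      kernel_big by (simp add: card_Diff_singleton)
  also have "\<dots> = ?q ^ r * (\<Sum>u\<in>UNIV. card {A \<in> M. u v* A = 0})"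
    by (simp add: sum.remove[of UNIV 0] distrib_left sum_distrib_left)
  also have "\<dots> = ?q ^ r * (\<Sum>A\<in>M. card {u. u v* A = 0})"
    by (simp only: double_count)
  \<comment> \<open>Likewise \<open>A = 0\<close> is split off: all \<open>q^m\<close> vectors
    annihilate it.\<close>
  also have "\<dots> = ?q ^ r * ?q ^ CARD('m) + (\<Sum>A\<in>M - {0}. ?q ^ r * card {u. u v* A = 0})"
    by (simp add: sum.remove[OF _ zero] distrib_left sum_distrib_left)
  also have "\<dots> = ?q ^ r * ?q ^ CARD('m) + (card M - 1) * ?q ^ CARD('m)"
    using zero by (simp add: left_kernel)
  finally have count: "?q ^ r * card M + (?q ^ CARD('m) - 1) * card M
      \<le> ?q ^ r * ?q ^ CARD('m) + (card M - 1) * ?q ^ CARD('m)" .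
  have "1 < ?q ^ r" using q1 assms(2) by (intro one_less_power) auto
  moreover have "?q ^ CARD('m) < card M"
    using power_increasing[OF assms(1), of ?q] q1 by (intro le_less_trans[OF _ big]) simp
  \<comment> \<open>Over the integers, where subtraction is not truncated, \<open>count\<close> says
    that this product is at most \<open>0\<close>.\<close>
  ultimately have "0 < (int (?q ^ r) - 1) * (int (card M) - int (?q ^ CARD('m)))"
    by (intro mult_pos_pos) linarith+
  moreover have "int (?q ^ CARD('m) - 1) = int (?q ^ CARD('m)) - 1"
    "int (card M - 1) = int (card M) - 1"
    using \<open>?q ^ CARD('m) < card M\<close> q1 by (simp_all add: of_nat_diff Suc_le_eq)
  moreover have "int (?q ^ r) * int (card M) + int (?q ^ CARD('m) - 1) * int (card M)
      \<le> int (?q ^ r) * int (?q ^ CARD('m)) + int (card M - 1) * int (?q ^ CARD('m))"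
    using count by (simp only: of_nat_mult[symmetric] of_nat_add[symmetric] of_nat_le_iff)
  ultimately show False by (simp add: algebra_simps)
qed

end
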